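(* Let $G$ be a finite connected graph and let $f:V(G)\to V(G)$ be an automorphism of $G$. Then the group $\tilde A(G,G,f)$ is a semidirect product $\tilde A(G,G,f)=\bar A(G,f)\ltimes\hat B(G,G,f)$; that is, $\hat B(G,G,f)$ is a normal subgroup of $\tilde A(G,G,f)$, $\bar A(G,f)$ is a subgroup, $\bar A(G,f)\cap\hat B(G,G,f)$ is trivial, and $\tilde A(G,G,f)=\bar A(G,f)\,\hat B(G,G,f)$.
   Context: Graphs are undirected and simple. For graphs $G,H$ and a function $f:V(G)\to V(H)$, the Sierpiński product $G\otimes_f H$ is the graph with vertex set $V(G)\times V(H)$ and the following edges: the inner edges $\{(g,h),(g,h')\}$ for every $g\in V(G)$ and every $\{h,h'\}\in E(H)$; and the connecting edges $\{(g,f(g')),(g',f(g))\}$ for every $\{g,g'\}\in E(G)$. An automorphism of $G\otimes_f H$ respects the fundamental edge partition if it takes inner edges to inner edges and connecting edges to connecting edges. $\tilde A(G,H,f)$ denotes the group of all automorphisms of $G\otimes_f H$ that respect the fundamental edge partition. For $g\in V(G)$ and $\beta\in\mathrm{Aut}(H)$, $\Phi(g,\beta)$ is the permutation of $V(G)\times V(H)$ that sends $(g,h)$ to $(g,\beta(h))$ for all $h\in V(H)$ and fixes $(g_1,h)$ for all $g_1\ne g$. $N(g)$ is the set of neighbours of $g$ in $G$, and $\mathrm{Aut}(H)_{f(N(g))}$ is the pointwise stabilizer of $f(N(g))$ in $\mathrm{Aut}(H)$. $\hat B(G,H,f)$ is the group generated by all $\Phi(g,\beta)$ with $g\in V(G)$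 and $\beta\in\mathrm{Aut}(H)_{f(N(g))}$ (these are automorphisms of $G\otimes_f H$ respecting the fundamental edge partition). For $H=G$ and $f\in\mathrm{Aut}(G)$, the diagonal automorphism of $G\otimes_f G$ corresponding to $\alpha\in\mathrm{Aut}(G)$ is $\bar\alpha:(g,h)\mapsto(\alpha(g),(f\circ\alpha\circ f^{-1})(h))$, and $\bar A(G,f)=\{\bar\alpha:\alpha\in\mathrm{Aut}(G)\}$. *)

theory Defs
  imports "HOL-Algebra.Bij" "HOL-Algebra.Coset" "HOL-Algebra.Generated_Groups"
begin

record 'a ugraph =
  verts :: "'a set"
  edges :: "'a set set"

definition simple_graph :: "'a ugraph \<Rightarrow> bool" where
  "simple_graph G \<longleftrightarrow> (\<forall>e\<in>edges G. e \<subseteq> verts G \<and> card e = 2)"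

definition finite_graph :: "'a ugraph \<Rightarrow> bool" where
  "finite_graph G \<longleftrightarrow> finite (verts G)"

(* Non-emptiness of the vertex set is deliberately not part of connectedness. *)
definition connected_graph :: "'a ugraph \<Rightarrow> bool" where
  "connected_graph G \<longleftrightarrow>
     (\<forall>u\<in>verts G. \<forall>v\<in>verts G. (u, v) \<in> {(x, y). {x, y} \<in> edges G}\<^sup>*)"

definition neighbours :: "'a ugraph \<Rightarrow> 'a \<Rightarrow> 'a set" where
  "neighbours G g = {g' \<in> verts G. {g, g'} \<in> edges G}"

(* Permutations of a vertex set V are the elements of BijGroup V: bijections of V that
   are extensional, i.e. have the value undefined outside V, so that equality of
   permutations is equality on V. The product in BijGroup V is composition. *)

definition graph_aut :: "'a ugraph \<Rightarrow> ('a \<Rightarrow> 'a) set" where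
  "graph_aut G = {\<phi> \<in> Bij (verts G).
     \<forall>u\<in>verts G. \<forall>v\<in>verts G. {\<phi> u, \<phi> v} \<in> edges G \<longleftrightarrow> {u, v} \<in> edges G}"

definition pointwise_stabilizer :: "'a ugraph \<Rightarrow> 'a set \<Rightarrow> ('a \<Rightarrow> 'a) set" where
  "pointwise_stabilizer G X = {\<beta> \<in> graph_aut G. \<forall>x\<in>X. \<beta> x = x}"

definition inner_edges :: "'a ugraph \<Rightarrow> 'b ugraph \<Rightarrow> ('a \<times> 'b) set set" where
  "inner_edges G H = {{(g, h), (g, h')} |g h h'. g \<in> verts G \<and> {h, h'} \<in> edges H}"

definition connecting_edges :: "'a ugraph \<Rightarrow> ('a \<Rightarrow> 'b) \<Rightarrow> ('a \<times> 'b) set set" where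
  "connecting_edges G f = {{(g, f g'), (g', f g)} |g g'. {g, g'} \<in> edges G}"

definition sierpinski_product ::
    "'a ugraph \<Rightarrow> 'b ugraph \<Rightarrow> ('a \<Rightarrow> 'b) \<Rightarrow> ('a \<times> 'b) ugraph" where
  "sierpinski_product G H f =
     \<lparr>verts = verts G \<times> verts H, edges = inner_edges G H \<union> connecting_edges G f\<rparr>"

definition A_tilde ::
    "'a ugraph \<Rightarrow> 'b ugraph \<Rightarrow> ('a \<Rightarrow> 'b) \<Rightarrow> ('a \<times> 'b \<Rightarrow> 'a \<times> 'b) set" where
  "A_tilde G H f = {\<phi> \<in> graph_aut (sierpinski_product G H f).
     (\<forall>e\<in>inner_edges G H. \<phi> ` e \<in> inner_edges G H) \<and>
     (\<forall>e\<in>connecting_edges G f. \<phi> ` e \<in> connecting_edges G f)}"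

definition A_tilde_group ::
    "'a ugraph \<Rightarrow> 'b ugraph \<Rightarrow> ('a \<Rightarrow> 'b) \<Rightarrow> ('a \<times> 'b \<Rightarrow> 'a \<times> 'b) monoid" where
  "A_tilde_group G H f = (BijGroup (verts G \<times> verts H))\<lparr>carrier := A_tilde G H f\<rparr>"

definition Phi ::
    "'a ugraph \<Rightarrow> 'b ugraph \<Rightarrow> 'a \<Rightarrow> ('b \<Rightarrow> 'b) \<Rightarrow> 'a \<times> 'b \<Rightarrow> 'a \<times> 'b" where
  "Phi G H g \<beta> =
     restrict (\<lambda>(g1, h). if g1 = g then (g, \<beta> h) else (g1, h)) (verts G \<times> verts H)"

definition B_hat ::
    "'a ugraph \<Rightarrow> 'b ugraph \<Rightarrow> ('a \<Rightarrow> 'b) \<Rightarrow> ('a \<times> 'b \<Rightarrow> 'a \<times> 'b) set" where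
  "B_hat G H f = generate (BijGroup (verts G \<times> verts H))
     {Phi G H g \<beta> |g \<beta>. g \<in> verts G \<and> \<beta> \<in> pointwise_stabilizer H (f ` neighbours G g)}"

definition diagonal_aut ::
    "'a ugraph \<Rightarrow> ('a \<Rightarrow> 'a) \<Rightarrow> ('a \<Rightarrow> 'a) \<Rightarrow> 'a \<times> 'a \<Rightarrow> 'a \<times> 'a" where
  "diagonal_aut G f \<alpha> =
     restrict (\<lambda>(g, h). (\<alpha> g, f (\<alpha> (inv_into (verts G) f h)))) (verts G \<times> verts G)"

definition A_bar :: "'a ugraph \<Rightarrow> ('a \<Rightarrow> 'a) \<Rightarrow> ('a \<times> 'a \<Rightarrow> 'a \<times> 'a) set" where
  "A_bar G f = {diagonal_aut G f \<alpha> |\<alpha>. \<alpha> \<in> graph_aut G}"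

end

theory Submission imports Defs begin

text \<open>Since the second factor is connected, an automorphism that takes inner edges to inner edges
  permutes the layers \<open>{g} \<times> V\<close>; let \<open>\<alpha>\<close> be the induced permutation of the first factor. Two
  distinct layers are joined by a connecting edge iff their indices are adjacent, so \<open>\<alpha>\<close> is a graph
  automorphism, and the endpoints of connecting edges are mapped as \<open>diagonal_aut G f \<alpha>\<close> maps them.
  The automorphisms that fix every layer, i.e. the kernel of \<open>\<phi> \<mapsto> \<alpha>\<close>, act on the layer of \<open>g\<close> by
  an automorphism fixing \<open>f ` neighbours G g\<close> pointwise, and hence are the products of the
  \<open>Phi G H g \<beta>\<close>. The diagonal automorphisms split this homomorphism.\<close>

section \<open>Permutations of a set and automorphism groups of graphs\<close>

lemma BijD:
  assumes "\<phi> \<in> Bij S"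
  shows "\<And>x. x \<in> S \<Longrightarrow> \<phi> x \<in> S" and "inj_on \<phi> S" and "\<phi> ` S = S" and "\<phi> \<in> extensional S"
  using assms by (auto simp: Bij_def bij_betw_def)

lemma BijI:
  assumes "\<phi> \<in> extensional S" "\<And>x. x \<in> S \<Longrightarrow> \<phi> x \<in> S" "inj_on \<phi> S" "S \<subseteq> \<phi> ` S"
  shows "\<phi> \<in> Bij S"
  using assms by (auto simp: Bij_def bij_betw_def)

lemma carrier_BijGroup: "carrier (BijGroup S) = Bij S"
  by (simp add: BijGroup_def)

lemma mult_BijGroup:
  "\<phi> \<in> Bij S \<Longrightarrow> \<psi> \<in> Bij S \<Longrightarrow> \<phi> \<otimes>\<^bsub>BijGroup S\<^esub> \<psi> = compose S \<phi> \<psi>"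
  by (simp add: BijGroup_def)

lemma one_BijGroup: "\<one>\<^bsub>BijGroup S\<^esub> = (\<lambda>x\<in>S. x)"
  by (simp add: BijGroup_def)

lemma inv_BijGroup_f:
  assumes "\<phi> \<in> Bij S" "x \<in> S"
  shows "(inv\<^bsub>BijGroup S\<^esub> \<phi>) x \<in> S" "\<phi> ((inv\<^bsub>BijGroup S\<^esub> \<phi>) x) = x"
    "(inv\<^bsub>BijGroup S\<^esub> \<phi>) (\<phi> x) = x"
  using assms BijD[OF assms(1)]
  by (auto simp: inv_BijGroup inv_into_into f_inv_into_f)

lemma simple_graphD:
  assumes "simple_graph G" "{u, v} \<in> edges G"
  shows "u \<in> verts G" "v \<in> verts G" "u \<noteq> v"
  using assms unfolding simple_graph_def by force+

text \<open>Besides \<open>Aut(G)\<close> itself, this serves for the graphs on the product vertex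
  set that carry only one of the two edge classes.\<close>

lemma graph_aut_subgroup: "subgroup (graph_aut G) (BijGroup (verts G))"
proof (rule group.subgroupI[OF group_BijGroup])
  show "graph_aut G \<subseteq> carrier (BijGroup (verts G))"
    by (auto simp: graph_aut_def carrier_BijGroup)
  have "(\<lambda>x\<in>verts G. x) \<in> graph_aut G"
    using id_Bij by (auto simp: graph_aut_def)
  then show "graph_aut G \<noteq> {}" by blast
next
  fix a assume a: "a \<in> graph_aut G"
  then have aB: "a \<in> Bij (verts G)" by (simp add: graph_aut_def)
  have iB: "inv\<^bsub>BijGroup (verts G)\<^esub> a \<in> Bij (verts G)"
    using aB group.inv_closed[OF group_BijGroup] by (metis carrier_BijGroup)
  show "inv\<^bsub>BijGroup (verts G)\<^esub> a \<in> graph_aut G"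
    unfolding graph_aut_def
  proof (intro CollectI conjI iB ballI)
    fix u v assume uv: "u \<in> verts G" "v \<in> verts G"
    let ?i = "inv\<^bsub>BijGroup (verts G)\<^esub> a"
    have "{a (?i u), a (?i v)} \<in> edges G \<longleftrightarrow> {?i u, ?i v} \<in> edges G"
      using a uv inv_BijGroup_f(1)[OF aB] unfolding graph_aut_def by blast
    then show "{?i u, ?i v} \<in> edges G \<longleftrightarrow> {u, v} \<in> edges G"
      by (simp add: inv_BijGroup_f(2)[OF aB] uv)
  qed
next
  fix a b assume ab: "a \<in> graph_aut G" "b \<in> graph_aut G"
  then have B: "a \<in> Bij (verts G)" "b \<in> Bij (verts G)" by (simp_all add: graph_aut_def)
  show "a \<otimes>\<^bsub>BijGroup (verts G)\<^esub> b \<in> graph_aut G"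
    using ab BijD(1)[OF B(2)] B by (auto simp: graph_aut_def mult_BijGroup compose_Bij compose_eq)
qed

section \<open>The two edge classes in coordinates\<close>

lemma inner_edges_iff:
  "{p, q} \<in> inner_edges G H \<longleftrightarrow>
     fst p = fst q \<and> fst p \<in> verts G \<and> {snd p, snd q} \<in> edges H"
  by (cases p; cases q) (auto simp: inner_edges_def doubleton_eq_iff insert_commute)

text \<open>The right-hand side is symmetric in \<open>p\<close> and \<open>q\<close>: exchanging
  them only exchanges \<open>g\<close> and \<open>g'\<close>. So the unordered pair can be tested in
  the order in which it is given.\<close>

lemma connecting_edges_iff:
  "{p, q} \<in> connecting_edges G f \<longleftrightarrow>
     {fst p, fst q} \<in> edges G \<and> snd p = f (fst q) \<and> snd q = f (fst p)"
  by (cases p; cases q) (auto simp: connecting_edges_def doubleton_eq_iff insert_commute)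

text \<open>Both ends of an inner edge lie in one layer, so a common edge would project to a loop of
  \<open>G\<close>.\<close>

lemma inner_connecting_disjoint:
  assumes "simple_graph G" "{p, q} \<in> inner_edges G H" "{p, q} \<in> connecting_edges G f"
  shows False
  using assms simple_graphD(3)[OF assms(1)] by (metis inner_edges_iff connecting_edges_iff)

section \<open>The group of partition-respecting automorphisms, for two arbitrary factors\<close>

locale sierpinski =
  fixes G :: "'a ugraph" and H :: "'b ugraph" and f :: "'a \<Rightarrow> 'b"
  assumes simple_G: "simple_graph G" and simple_H: "simple_graph H"
    and f_verts: "\<And>g. g \<in> verts G \<Longrightarrow> f g \<in> verts H"
begin

abbreviation "W \<equiv> verts G \<times> verts H"

text \<open>The definition asks only that each class be mapped into itself. The converse holds
  because the classes are disjoint: if the image of a pair is inner, the pair is an edge, and it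
  cannot be connecting since its image would then be connecting as well; likewise with the classes
  exchanged. The intersection form yields the subgroup property at once.\<close>

lemma A_tilde_eq:
  "A_tilde G H f =
     graph_aut \<lparr>verts = W, edges = inner_edges G H\<rparr> \<inter>
     graph_aut \<lparr>verts = W, edges = connecting_edges G f\<rparr>" (is "_ = ?R")
proof (intro equalityI subsetI)
  fix \<phi> assume \<phi>: "\<phi> \<in> A_tilde G H f"
  have B: "\<phi> \<in> Bij W"
    using \<phi> by (simp add: A_tilde_def graph_aut_def sierpinski_product_def)
  have e: "{p, q} \<in> inner_edges G H \<or> {p, q} \<in> connecting_edges G f"
    if "{\<phi> p, \<phi> q} \<in> inner_edges G H \<or> {\<phi> p, \<phi> q} \<in> connecting_edges G f"
      "p \<in> W" "q \<in> W" for p q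
    using \<phi> that unfolding A_tilde_def graph_aut_def sierpinski_product_def
    by (simp del: split_paired_Ball_Sigma)
  have i: "{\<phi> p, \<phi> q} \<in> inner_edges G H" if "{p, q} \<in> inner_edges G H" for p q
  proof -
    have "\<phi> ` {p, q} \<in> inner_edges G H" using \<phi> that unfolding A_tilde_def by blast
    then show ?thesis by simp
  qed
  have c: "{\<phi> p, \<phi> q} \<in> connecting_edges G f" if "{p, q} \<in> connecting_edges G f" for p q
  proof -
    have "\<phi> ` {p, q} \<in> connecting_edges G f" using \<phi> that unfolding A_tilde_def by blast
    then show ?thesis by simp
  qed
  have "{\<phi> p, \<phi> q} \<in> inner_edges G H \<longleftrightarrow> {p, q} \<in> inner_edges G H"
    "{\<phi> p, \<phi> q} \<in> connecting_edges G f \<longleftrightarrow> {p, q} \<in> connecting_edges G f"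
    if "p \<in> W" "q \<in> W" for p q
    using e[OF _ that] i[of p q] c[of p q]
      inner_connecting_disjoint[OF simple_G, of "\<phi> p" "\<phi> q" H f] by blast+
  with B show "\<phi> \<in> ?R"
    by (auto simp: graph_aut_def)
next
  fix \<phi> assume R: "\<phi> \<in> ?R"
  \<comment> \<open>\<open>graph_aut\<close> speaks only of vertices in \<open>W\<close>, so the
    ends of each edge must be placed in \<open>W\<close> first: by \<open>simple_H\<close> here, by
    \<open>simple_G\<close> and \<open>f_verts\<close> for connecting edges.\<close>
  have *: "\<phi> ` e \<in> inner_edges G H" if "e \<in> inner_edges G H" for e
  proof -
    from that obtain g h h' where e: "e = {(g, h), (g, h')}" "g \<in> verts G" "{h, h'} \<in> edges H"
      by (auto simp: inner_edges_def)
    with simple_graphD[OF simple_H e(3)] R that show ?thesis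
      by (auto simp: graph_aut_def)
  qed
  have **: "\<phi> ` e \<in> connecting_edges G f" if "e \<in> connecting_edges G f" for e
  proof -
    from that obtain g g' where e: "e = {(g, f g'), (g', f g)}" "{g, g'} \<in> edges G"
      by (auto simp: connecting_edges_def)
    with simple_graphD[OF simple_G e(2)] R that f_verts show ?thesis
      by (auto simp: graph_aut_def)
  qed
  show "\<phi> \<in> A_tilde G H f"
    using R * ** by (auto simp: A_tilde_def graph_aut_def sierpinski_product_def)
qed

lemma A_tilde_iff:
  "\<phi> \<in> A_tilde G H f \<longleftrightarrow> \<phi> \<in> Bij W \<and>
     (\<forall>p\<in>W. \<forall>q\<in>W. {\<phi> p, \<phi> q} \<in> inner_edges G H \<longleftrightarrow> {p, q} \<in> inner_edges G H) \<and>
     (\<forall>p\<in>W. \<forall>q\<in>W. {\<phi> p, \<phi> q} \<in> connecting_edges G f \<longleftrightarrow> {p, q} \<in> connecting_edges G f)"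
  unfolding A_tilde_eq by (auto simp: graph_aut_def)

lemma A_tilde_subgroup: "subgroup (A_tilde G H f) (BijGroup W)"
  unfolding A_tilde_eq
  by (rule group.subgroups_Inter_pair[OF group_BijGroup])
     (use graph_aut_subgroup[of "\<lparr>verts = W, edges = inner_edges G H\<rparr>"]
       graph_aut_subgroup[of "\<lparr>verts = W, edges = connecting_edges G f\<rparr>"] in simp_all)

lemma group_A_tilde: "group (A_tilde_group G H f)"
  unfolding A_tilde_group_def
  using subgroup.subgroup_is_group[OF A_tilde_subgroup group_BijGroup] .

lemma carrier_A_tilde_group: "carrier (A_tilde_group G H f) = A_tilde G H f"
  by (simp add: A_tilde_group_def)

lemma A_tilde_Bij: "\<phi> \<in> A_tilde G H f \<Longrightarrow> \<phi> \<in> Bij W"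
  by (simp add: A_tilde_iff)

lemma mult_A_tilde:
  "\<phi> \<in> A_tilde G H f \<Longrightarrow> \<psi> \<in> A_tilde G H f \<Longrightarrow> \<phi> \<otimes>\<^bsub>A_tilde_group G H f\<^esub> \<psi> = compose W \<phi> \<psi>"
  by (simp add: A_tilde_group_def mult_BijGroup A_tilde_Bij)

lemma one_A_tilde: "\<one>\<^bsub>A_tilde_group G H f\<^esub> = (\<lambda>x\<in>W. x)"
  by (simp add: A_tilde_group_def one_BijGroup)

text \<open>Gives access to the pointwise rules \<open>inv_BijGroup_f\<close> for inverses taken in
  the smaller group.\<close>

lemma inv_A_tilde:
  "\<phi> \<in> A_tilde G H f \<Longrightarrow> inv\<^bsub>A_tilde_group G H f\<^esub> \<phi> = inv\<^bsub>BijGroup W\<^esub> \<phi>"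
  unfolding A_tilde_group_def
  using group.m_inv_consistent[OF group_BijGroup A_tilde_subgroup] .

section \<open>Layers as blocks, and the kernel of the action on them\<close>

lemma A_tilde_layer:
  assumes conn: "connected_graph H" and \<phi>: "\<phi> \<in> A_tilde G H f"
    and p: "p \<in> W" and q: "q \<in> W" and pq: "fst p = fst q"
  shows "fst (\<phi> p) = fst (\<phi> q)"
proof -
  have "(snd p, snd q) \<in> {(x, y). {x, y} \<in> edges H}\<^sup>*"
    using conn p q by (auto simp: connected_graph_def)
  \<comment> \<open>Follow a walk in \<open>H\<close> from \<open>snd p\<close> to
    \<open>snd q\<close>. Each of its steps is an inner edge of the layer, whose image is again
    inner and so does not leave the image layer.\<close>
  then have "fst (\<phi> (fst p, snd p)) = fst (\<phi> (fst p, snd q))"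
  proof induction
    case (step y z)
    then have "{(fst p, y), (fst p, z)} \<in> inner_edges G H"
      using p by (auto simp: inner_edges_iff)
    moreover have "(fst p, y) \<in> W" "(fst p, z) \<in> W"
      using step p simple_graphD[OF simple_H, of y z] by auto
    ultimately have "{\<phi> (fst p, y), \<phi> (fst p, z)} \<in> inner_edges G H"
      using \<phi> unfolding A_tilde_iff by blast
    with step show ?case by (simp add: inner_edges_iff)
  qed simp
  then show ?thesis using pq by (metis prod.collapse)
qed

text \<open>Phrased through first coordinates, so that the permutation of layers induced by an
  automorphism need not be constructed here.\<close>

definition layer_kernel :: "('a \<times> 'b \<Rightarrow> 'a \<times> 'b) set" where
  "layer_kernel = {\<psi> \<in> A_tilde G H f. \<forall>p\<in>W. fst (\<psi> p) = fst p}"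

lemma layer_kernelD:
  assumes "\<psi> \<in> layer_kernel"
  shows "\<psi> \<in> A_tilde G H f" and "\<And>p. p \<in> W \<Longrightarrow> fst (\<psi> p) = fst p"
  using assms unfolding layer_kernel_def by blast+

text \<open>In a conjugate of \<open>k\<close> by \<open>x\<close>, the inverse of \<open>x\<close>
  carries a point to some layer, \<open>k\<close> moves it within that layer, and \<open>x\<close>
  carries the whole layer back to the original one, since layers are blocks.\<close>

lemma layer_kernel_normal:
  assumes "connected_graph H"
  shows "layer_kernel \<lhd> A_tilde_group G H f"
proof -
  interpret A: group "A_tilde_group G H f" by (rule group_A_tilde)
  have sub: "subgroup layer_kernel (A_tilde_group G H f)"
  proof (rule A.subgroupI)
    show "layer_kernel \<subseteq> carrier (A_tilde_group G H f)"
      by (auto simp: layer_kernel_def carrier_A_tilde_group)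
    have "\<one>\<^bsub>A_tilde_group G H f\<^esub> \<in> layer_kernel"
      using A.one_closed by (simp add: layer_kernel_def carrier_A_tilde_group one_A_tilde)
    then show "layer_kernel \<noteq> {}" by blast
  next
    fix a assume a: "a \<in> layer_kernel"
    then have aA: "a \<in> A_tilde G H f" by (simp add: layer_kernel_def)
    have "fst ((inv\<^bsub>BijGroup W\<^esub> a) p) = fst p" if "p \<in> W" for p
      using layer_kernelD(2)[OF a inv_BijGroup_f(1)[OF A_tilde_Bij[OF aA] that]]
        inv_BijGroup_f(2)[OF A_tilde_Bij[OF aA] that] by simp
    then show "inv\<^bsub>A_tilde_group G H f\<^esub> a \<in> layer_kernel"
      using A.inv_closed[of a] aA
      by (simp add: layer_kernel_def carrier_A_tilde_group inv_A_tilde)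
  next
    fix a b assume ab: "a \<in> layer_kernel" "b \<in> layer_kernel"
    then have A: "a \<in> A_tilde G H f" "b \<in> A_tilde G H f" by (auto simp: layer_kernel_def)
    have "fst (compose W a b p) = fst p" if "p \<in> W" for p
      using layer_kernelD(2)[OF ab(1) BijD(1)[OF A_tilde_Bij[OF A(2)] that]]
        layer_kernelD(2)[OF ab(2) that] that by (simp add: compose_eq)
    then show "a \<otimes>\<^bsub>A_tilde_group G H f\<^esub> b \<in> layer_kernel"
      using A.m_closed[of a b] A by (simp add: layer_kernel_def carrier_A_tilde_group mult_A_tilde)
  qed
  show ?thesis
    unfolding A.normal_inv_iff
  proof (intro conjI sub ballI)
    fix x k assume x': "x \<in> carrier (A_tilde_group G H f)" and k: "k \<in> layer_kernel"
    let ?i = "inv\<^bsub>A_tilde_group G H f\<^esub> x"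
    have x: "x \<in> A_tilde G H f" and i: "?i \<in> A_tilde G H f" and kA: "k \<in> A_tilde G H f"
      using x' k A.inv_closed[OF x'] by (auto simp: carrier_A_tilde_group layer_kernel_def)
    have xk: "x \<otimes>\<^bsub>A_tilde_group G H f\<^esub> k \<in> A_tilde G H f"
      using A.m_closed x kA by (simp add: carrier_A_tilde_group)
    have m: "x \<otimes>\<^bsub>A_tilde_group G H f\<^esub> k \<otimes>\<^bsub>A_tilde_group G H f\<^esub> ?i = compose W (compose W x k) ?i"
      using mult_A_tilde[OF xk i] by (simp only: mult_A_tilde[OF x kA])
    have "fst (compose W (compose W x k) ?i p) = fst p" if p: "p \<in> W" for p
    proof -
      have ip: "?i p \<in> W" "x (?i p) = p"
        using inv_BijGroup_f[OF A_tilde_Bij[OF x] p] by (simp_all add: inv_A_tilde x)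
      have "fst (x (k (?i p))) = fst (x (?i p))"
        using A_tilde_layer[OF assms x BijD(1)[OF A_tilde_Bij[OF kA] ip(1)] ip(1)]
          layer_kernelD(2)[OF k ip(1)] .
      then show ?thesis using p ip by (simp add: compose_eq)
    qed
    moreover have "compose W (compose W x k) ?i \<in> A_tilde G H f"
      using A.m_closed[of _ ?i] xk i by (simp only: carrier_A_tilde_group flip: m)
    ultimately show "x \<otimes>\<^bsub>A_tilde_group G H f\<^esub> k \<otimes>\<^bsub>A_tilde_group G H f\<^esub> ?i \<in> layer_kernel"
      by (simp add: m layer_kernel_def)
  qed
qed

section \<open>The generators, and the identification of \<open>B_hat\<close> with the layer
  kernel\<close>

lemma Phi_Bij:
  assumes g: "g \<in> verts G" and \<beta>: "\<beta> \<in> Bij (verts H)"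
  shows "Phi G H g \<beta> \<in> Bij W"
proof (rule BijI)
  note b = BijD[OF \<beta>]
  show "Phi G H g \<beta> p \<in> W" if "p \<in> W" for p
    using that b(1) g by (auto simp: Phi_def)
  show "inj_on (Phi G H g \<beta>) W"
    using b(2) by (auto simp: inj_on_def Phi_def split: if_splits)
  show "W \<subseteq> Phi G H g \<beta> ` W"
  proof
    fix p assume p: "p \<in> W"
    obtain h where h: "h \<in> verts H" "snd p = \<beta> h"
      using b(3) p by (metis imageE mem_Times_iff)
    show "p \<in> Phi G H g \<beta> ` W"
    proof (cases "fst p = g")
      case True
      then have "Phi G H g \<beta> (g, h) = p" using h g by (simp add: Phi_def prod_eq_iff)
      then show ?thesis using h g by (metis imageI mem_Sigma_iff)
    next
      case False
      then have "Phi G H g \<beta> p = p" using p by (auto simp: Phi_def)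
      then show ?thesis using p by (metis imageI)
    qed
  qed
qed (simp add: Phi_def)

text \<open>Inner edges survive because \<beta> is an automorphism of \<open>H\<close>. A connecting
  edge meets the layer of \<open>g\<close> only in a point \<open>(g, f g')\<close> with
  \<open>g'\<close> a neighbour of \<open>g\<close>, and \<beta> fixes these points.\<close>

lemma Phi_layer_kernel:
  assumes g: "g \<in> verts G" and \<beta>: "\<beta> \<in> pointwise_stabilizer H (f ` neighbours G g)"
  shows "Phi G H g \<beta> \<in> layer_kernel"
proof -
  have a: "\<beta> \<in> graph_aut H" and fix_\<beta>: "\<And>x. x \<in> neighbours G g \<Longrightarrow> \<beta> (f x) = f x"
    using \<beta> by (auto simp: pointwise_stabilizer_def)
  then have B: "\<beta> \<in> Bij (verts H)" by (simp add: graph_aut_def)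
  note b = BijD[OF B]
  \<comment> \<open>Injectivity turns the fixed point into an equivalence: no other vertex is sent
    to \<open>f g'\<close>, so no new connecting edges arise.\<close>
  have \<beta>_iff: "\<beta> h = f g' \<longleftrightarrow> h = f g'" if "{g, g'} \<in> edges G" "h \<in> verts H" for h g'
  proof -
    have "g' \<in> verts G" using simple_graphD[OF simple_G that(1)] by simp
    with that fix_\<beta>[of g'] have "\<beta> (f g') = f g'" by (simp add: neighbours_def)
    then show ?thesis
      using b(2) f_verts[OF \<open>g' \<in> verts G\<close>] that(2) by (metis inj_on_eq_iff)
  qed
  have edge: "\<And>h h'. h \<in> verts H \<Longrightarrow> h' \<in> verts H \<Longrightarrow>
      {\<beta> h, \<beta> h'} \<in> edges H \<longleftrightarrow> {h, h'} \<in> edges H"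
    using a by (simp add: graph_aut_def)
  have "Phi G H g \<beta> \<in> A_tilde G H f"
    unfolding A_tilde_iff
  proof (intro conjI ballI Phi_Bij[OF g B])
    fix p q assume pq: "p \<in> W" "q \<in> W"
    then show "{Phi G H g \<beta> p, Phi G H g \<beta> q} \<in> inner_edges G H \<longleftrightarrow> {p, q} \<in> inner_edges G H"
      using edge g by (cases p; cases q) (auto simp: inner_edges_iff Phi_def split: if_splits)
    show "{Phi G H g \<beta> p, Phi G H g \<beta> q} \<in> connecting_edges G f \<longleftrightarrow> {p, q} \<in> connecting_edges G f"
      using pq \<beta>_iff simple_graphD(3)[OF simple_G]
      by (cases p; cases q) (auto simp: connecting_edges_iff Phi_def insert_commute)
  qed
  then show ?thesis by (auto simp: layer_kernel_def Phi_def)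
qed

text \<open>Converse to \<open>Phi_layer_kernel\<close>: the inner edges in the layer of
  \<open>g\<close> form a copy of \<open>H\<close>, on which \<psi> acts, and the connecting edges
  leaving the layer force the fixed points.\<close>

lemma layer_kernel_stabilizer:
  assumes \<psi>: "\<psi> \<in> layer_kernel" and g: "g \<in> verts G"
  shows "(\<lambda>h\<in>verts H. snd (\<psi> (g, h))) \<in> pointwise_stabilizer H (f ` neighbours G g)"
proof -
  have A: "\<psi> \<in> A_tilde G H f" and fs: "\<And>p. p \<in> W \<Longrightarrow> fst (\<psi> p) = fst p"
    using \<psi> by (auto simp: layer_kernel_def)
  note b = BijD[OF A_tilde_Bij[OF A]]
  have \<psi>_eq: "\<psi> (g, h) = (g, snd (\<psi> (g, h)))" if "h \<in> verts H" for h
    using fs[of "(g, h)"] that g by (simp add: prod_eq_iff)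
  have closed: "snd (\<psi> (g, h)) \<in> verts H" if "h \<in> verts H" for h
    using b(1)[of "(g, h)"] that g by auto
  have B: "(\<lambda>h\<in>verts H. snd (\<psi> (g, h))) \<in> Bij (verts H)"
  proof (rule BijI)
    show "inj_on (\<lambda>h\<in>verts H. snd (\<psi> (g, h))) (verts H)"
    proof (rule inj_onI)
      fix h h' assume h: "h \<in> verts H" "h' \<in> verts H"
        "(\<lambda>h\<in>verts H. snd (\<psi> (g, h))) h = (\<lambda>h\<in>verts H. snd (\<psi> (g, h))) h'"
      then have "\<psi> (g, h) = \<psi> (g, h')" using \<psi>_eq[of h] \<psi>_eq[of h'] by simp
      then show "h = h'" using inj_onD[OF b(2), of "(g, h)" "(g, h')"] h g by auto
    qed
    show "verts H \<subseteq> (\<lambda>h\<in>verts H. snd (\<psi> (g, h))) ` verts H"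
    proof
      fix h assume h: "h \<in> verts H"
      \<comment> \<open>The preimage of \<open>(g, h)\<close> under \<psi> lies in the layer of
        \<open>g\<close> because \<psi> keeps every layer, so its second coordinate is the required
        preimage of \<open>h\<close>.\<close>
      then have "(g, h) \<in> \<psi> ` W" using b(3) g by simp
      then obtain p where p: "p \<in> W" "\<psi> p = (g, h)" by (metis imageE)
      then have "p = (g, snd p)" using fs[OF p(1)] by (simp add: prod_eq_iff)
      then show "h \<in> (\<lambda>h\<in>verts H. snd (\<psi> (g, h))) ` verts H"
        using p by (intro image_eqI[of _ _ "snd p"]) auto
    qed
  qed (use closed in auto)
  have "{snd (\<psi> (g, h)), snd (\<psi> (g, h'))} \<in> edges H \<longleftrightarrow> {h, h'} \<in> edges H"
    if "h \<in> verts H" "h' \<in> verts H" for h h'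
  proof -
    have "{\<psi> (g, h), \<psi> (g, h')} \<in> inner_edges G H \<longleftrightarrow> {(g, h), (g, h')} \<in> inner_edges G H"
      using A that g unfolding A_tilde_iff by blast
    then show ?thesis
      using fs[of "(g, h)"] fs[of "(g, h')"] g that by (simp add: inner_edges_iff)
  qed
  \<comment> \<open>The image of the connecting edge between the layers of \<open>g\<close> and
    \<open>g'\<close> is again a connecting edge between them. There is only one, and its end in the
    layer of \<open>g\<close> is \<open>(g, f g')\<close>.\<close>
  moreover have "snd (\<psi> (g, f g')) = f g'" if "g' \<in> neighbours G g" for g'
  proof -
    from that have g': "g' \<in> verts G" "{g, g'} \<in> edges G" by (auto simp: neighbours_def)
    then have "{\<psi> (g, f g'), \<psi> (g', f g)} \<in> connecting_edges G f"
      using A g f_verts unfolding A_tilde_iff by (simp add: connecting_edges_iff)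
    then show ?thesis
      using fs[of "(g', f g)"] g g' f_verts by (simp add: connecting_edges_iff)
  qed
  ultimately show ?thesis
    using B f_verts by (auto simp: pointwise_stabilizer_def graph_aut_def neighbours_def)
qed

text \<open>A member of the kernel is the product of its restrictions to the single layers, each a
  generator. Finiteness of \<open>verts G\<close> makes this a finite product, as membership in a
  generated group requires.\<close>

lemma B_hat_eq_layer_kernel:
  assumes fin: "finite (verts G)" and conn: "connected_graph H"
  shows "B_hat G H f = layer_kernel"
proof
  let ?S = "{Phi G H g \<beta> |g \<beta>. g \<in> verts G \<and> \<beta> \<in> pointwise_stabilizer H (f ` neighbours G g)}"
  \<comment> \<open>\<open>B_hat\<close> is generated inside \<open>BijGroup W\<close>, so the
    kernel has to be a subgroup of that larger group.\<close>
  have "subgroup layer_kernel (BijGroup W)"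
    using group.incl_subgroup[OF group_BijGroup A_tilde_subgroup]
      normal_imp_subgroup[OF layer_kernel_normal[OF conn]]
    by (simp add: A_tilde_group_def)
  then show "B_hat G H f \<subseteq> layer_kernel"
    unfolding B_hat_def using Phi_layer_kernel
    by (intro group.generate_subgroup_incl[OF group_BijGroup]) auto
  show "layer_kernel \<subseteq> B_hat G H f"
  proof
    fix \<psi> assume \<psi>: "\<psi> \<in> layer_kernel"
    then have fs: "\<And>p. p \<in> W \<Longrightarrow> fst (\<psi> p) = fst p" and \<psi>B: "\<psi> \<in> Bij W"
      using layer_kernelD A_tilde_Bij by blast+
    \<comment> \<open>\<open>r S\<close> acts as \<psi> on the layers indexed by \<open>S\<close>
      and trivially elsewhere. It leads from the identity at \<open>{}\<close> to \<psi> at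
      \<open>verts G\<close>, gaining one generator with each new layer.\<close>
    define r where "r S = (\<lambda>p\<in>W. if fst p \<in> S then \<psi> p else p)" for S
    have gen_Bij: "x \<in> B_hat G H f \<Longrightarrow> x \<in> Bij W" for x
      using \<open>B_hat G H f \<subseteq> layer_kernel\<close> A_tilde_Bij[OF layer_kernelD(1)] by blast
    have "r S \<in> B_hat G H f" if "S \<subseteq> verts G" "finite S" for S
      using that(2,1)
    proof induction
      case empty
      have "r {} = \<one>\<^bsub>BijGroup W\<^esub>" by (simp add: r_def one_BijGroup)
      then show ?case using generate.one[of "BijGroup W" ?S] by (simp only: B_hat_def)
    next
      case (insert g S)
      let ?\<beta> = "\<lambda>h\<in>verts H. snd (\<psi> (g, h))"
      have g: "g \<in> verts G" and IH: "r S \<in> B_hat G H f"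
        using insert.prems insert.IH by simp_all
      have \<beta>: "?\<beta> \<in> pointwise_stabilizer H (f ` neighbours G g)"
        by (rule layer_kernel_stabilizer[OF \<psi> g])
      then have inS: "Phi G H g ?\<beta> \<in> ?S" using g by blast
      then have P: "Phi G H g ?\<beta> \<in> B_hat G H f" unfolding B_hat_def by (rule generate.incl)
      have "Phi G H g ?\<beta> \<otimes>\<^bsub>BijGroup W\<^esub> r S \<in> B_hat G H f"
        using P IH unfolding B_hat_def by (rule generate.eng)
      moreover have "Phi G H g ?\<beta> \<otimes>\<^bsub>BijGroup W\<^esub> r S = compose W (Phi G H g ?\<beta>) (r S)"
        by (rule mult_BijGroup[OF gen_Bij[OF P] gen_Bij[OF IH]])
      \<comment> \<open>As \<open>g\<close> is not in \<open>S\<close>, \<open>r S\<close> is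
        trivial on the layer of \<open>g\<close>, where the generator then acts alone. On every
        other layer \<open>r S\<close> keeps first coordinates, so the generator does
        nothing.\<close>
      moreover have "compose W (Phi G H g ?\<beta>) (r S) = r (insert g S)"
      proof
        fix p
        show "compose W (Phi G H g ?\<beta>) (r S) p = r (insert g S) p"
        proof (cases "p \<in> W")
          case True
          then obtain a b where p: "p = (a, b)" "a \<in> verts G" "b \<in> verts H" by blast
          obtain c d where \<psi>p: "\<psi> (a, b) = (c, d)" by (metis surj_pair)
          have "c = a" "d \<in> verts H"
            using fs[OF True] BijD(1)[OF \<psi>B True] by (simp_all add: p \<psi>p)
          then show ?thesis
            using p \<psi>p g insert.hyps(2) by (auto simp: r_def compose_eq Phi_def)
        next
          case False
          then show ?thesis by (auto simp: r_def compose_def)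
        qed
      qed
      ultimately show ?case by simp
    qed
    from this[OF order_refl fin] have "r (verts G) \<in> B_hat G H f" .
    moreover have "r (verts G) = \<psi>"
      using BijD(4)[OF \<psi>B] by (intro extensionalityI[of _ W]) (auto simp: r_def)
    ultimately show "\<psi> \<in> B_hat G H f" by simp
  qed
qed

end

section \<open>Equal factors: the diagonal automorphisms\<close>

lemma graph_aut_verts: "\<alpha> \<in> graph_aut G \<Longrightarrow> v \<in> verts G \<Longrightarrow> \<alpha> v \<in> verts G"
  by (auto simp: graph_aut_def dest: BijD(1))

lemma graph_aut_edge:
  "\<alpha> \<in> graph_aut G \<Longrightarrow> u \<in> verts G \<Longrightarrow> v \<in> verts G \<Longrightarrow>
    {\<alpha> u, \<alpha> v} \<in> edges G \<longleftrightarrow> {u, v} \<in> edges G"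
  by (simp add: graph_aut_def)

lemma graph_aut_eq_iff:
  "\<alpha> \<in> graph_aut G \<Longrightarrow> u \<in> verts G \<Longrightarrow> v \<in> verts G \<Longrightarrow> \<alpha> u = \<alpha> v \<longleftrightarrow> u = v"
  by (auto simp: graph_aut_def dest: BijD(2) inj_onD)

locale diagonal_sierpinski =
  fixes G :: "'a ugraph" and f :: "'a \<Rightarrow> 'a"
  assumes simple: "simple_graph G" and fin: "finite (verts G)" and conn: "connected_graph G"
    and f: "f \<in> graph_aut G"
begin

sublocale sierpinski G G f
  using simple f by unfold_locales (auto simp: graph_aut_verts)

abbreviation "f' \<equiv> inv_into (verts G) f"

lemma f_image: "f ` verts G = verts G"
  using f by (simp add: graph_aut_def BijD(3))

lemma f'_verts [simp]: "v \<in> verts G \<Longrightarrow> f' v \<in> verts G"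
  using f_image by (metis inv_into_into)

lemma f_f' [simp]: "v \<in> verts G \<Longrightarrow> f (f' v) = v"
  using f_image by (metis f_inv_into_f)

lemma f'_f [simp]: "v \<in> verts G \<Longrightarrow> f' (f v) = v"
  using f by (auto simp: graph_aut_def dest: BijD(2))

text \<open>The second coordinate moves by the conjugate of \<alpha> by \<open>f\<close>, an
  automorphism of \<open>G\<close>, which settles inner edges. The conjugation sends
  \<open>(g, f g')\<close> to \<open>(\<alpha> g, f (\<alpha> g'))\<close>, which settles connecting
  edges.\<close>

lemma diagonal_aut_A_tilde:
  assumes \<alpha>: "\<alpha> \<in> graph_aut G"
  shows "diagonal_aut G f \<alpha> \<in> A_tilde G G f"
  unfolding A_tilde_iff
proof (intro conjI ballI)
  have V: "\<And>v. v \<in> verts G \<Longrightarrow> \<alpha> v \<in> verts G" using \<alpha> by (rule graph_aut_verts)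
  show "diagonal_aut G f \<alpha> \<in> Bij W"
  proof (rule BijI)
    show "inj_on (diagonal_aut G f \<alpha>) W"
    proof (rule inj_onI)
      fix p q assume pq: "p \<in> W" "q \<in> W" "diagonal_aut G f \<alpha> p = diagonal_aut G f \<alpha> q"
      obtain g h where p: "p = (g, h)" "g \<in> verts G" "h \<in> verts G" using pq(1) by blast
      obtain g' h' where q: "q = (g', h')" "g' \<in> verts G" "h' \<in> verts G" using pq(2) by blast
      have "\<alpha> g = \<alpha> g'" "f (\<alpha> (f' h)) = f (\<alpha> (f' h'))"
        using pq(3) p q by (simp_all add: diagonal_aut_def)
      then have g: "g = g'" and h: "f' h = f' h'"
        using p q V by (simp_all add: graph_aut_eq_iff[OF \<alpha>] graph_aut_eq_iff[OF f])
      have "h = h'" using arg_cong[OF h, of f] by (simp only: f_f' p q)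
      then show "p = q" using p(1) q(1) g by blast
    qed
    have img: "\<alpha> ` verts G = verts G" using \<alpha> by (simp add: graph_aut_def BijD(3))
    show "W \<subseteq> diagonal_aut G f \<alpha> ` W"
    proof
      fix p assume "p \<in> W"
      then obtain u v where p: "p = (u, v)" "u \<in> verts G" "v \<in> verts G" by blast
      obtain g where g: "g \<in> verts G" "u = \<alpha> g" using img p(2) by blast
      \<comment> \<open>The preimage of \<open>v\<close> under the conjugate is \<open>f h\<close>,
        where \<alpha> takes \<open>h\<close> to \<open>f' v\<close>.\<close>
      obtain h where h: "h \<in> verts G" "f' v = \<alpha> h" using img f'_verts[OF p(3)] by blast
      have "f (\<alpha> h) = v" using f_f'[OF p(3)] h(2) by simp
      then have "p = diagonal_aut G f \<alpha> (g, f h)"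
        using p g h f_verts by (simp add: diagonal_aut_def)
      then show "p \<in> diagonal_aut G f \<alpha> ` W"
        using g h f_verts by blast
    qed
  qed (use V f_verts in \<open>auto simp: diagonal_aut_def\<close>)
  fix p q assume pq: "p \<in> W" "q \<in> W"
  \<comment> \<open>Three edge equivalences are chained, one each for the inverse of
    \<open>f\<close>, for \<alpha> and for \<open>f\<close>.\<close>
  have "{f (\<alpha> (f' h)), f (\<alpha> (f' h'))} \<in> edges G \<longleftrightarrow> {h, h'} \<in> edges G"
    if "h \<in> verts G" "h' \<in> verts G" for h h'
    using graph_aut_edge[OF f, of "f' h" "f' h'"] graph_aut_edge[OF f, of "\<alpha> (f' h)" "\<alpha> (f' h')"]
      graph_aut_edge[OF \<alpha>, of "f' h" "f' h'"] that V by simp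
  then show "{diagonal_aut G f \<alpha> p, diagonal_aut G f \<alpha> q} \<in> inner_edges G G \<longleftrightarrow>
      {p, q} \<in> inner_edges G G"
    using pq V graph_aut_eq_iff[OF \<alpha>] by (auto simp: diagonal_aut_def inner_edges_iff)
  have "f (\<alpha> (f' h)) = f (\<alpha> g) \<longleftrightarrow> h = f g" if "h \<in> verts G" "g \<in> verts G" for h g
  proof -
    have "f (\<alpha> (f' h)) = f (\<alpha> g) \<longleftrightarrow> f' h = g"
      using that V graph_aut_eq_iff[OF f] graph_aut_eq_iff[OF \<alpha>] by simp
    then show ?thesis using that by auto
  qed
  then show "{diagonal_aut G f \<alpha> p, diagonal_aut G f \<alpha> q} \<in> connecting_edges G f \<longleftrightarrow>
      {p, q} \<in> connecting_edges G f"
    using pq graph_aut_edge[OF \<alpha>] by (auto simp: diagonal_aut_def connecting_edges_iff)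
qed

text \<open>\<open>A_bar\<close> is the image of \<open>Aut(G)\<close> under a homomorphism: in a
  composite of two diagonal automorphisms the inner \<open>f'\<close> and \<open>f\<close>
  cancel.\<close>

lemma A_bar_subgroup: "subgroup (A_bar G f) (A_tilde_group G G f)"
proof -
  let ?Aut = "(BijGroup (verts G))\<lparr>carrier := graph_aut G\<rparr>"
  have "diagonal_aut G f \<in> hom ?Aut (A_tilde_group G G f)"
  proof (rule homI)
    fix \<alpha> \<beta> assume "\<alpha> \<in> carrier ?Aut" "\<beta> \<in> carrier ?Aut"
    then have \<alpha>: "\<alpha> \<in> graph_aut G" and \<beta>: "\<beta> \<in> graph_aut G" by auto
    have "diagonal_aut G f (compose (verts G) \<alpha> \<beta>) =
        compose W (diagonal_aut G f \<alpha>) (diagonal_aut G f \<beta>)"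
      using \<beta> f_verts by (auto simp: diagonal_aut_def compose_def restrict_def fun_eq_iff graph_aut_verts)
    then show "diagonal_aut G f (\<alpha> \<otimes>\<^bsub>?Aut\<^esub> \<beta>) =
        diagonal_aut G f \<alpha> \<otimes>\<^bsub>A_tilde_group G G f\<^esub> diagonal_aut G f \<beta>"
      using \<alpha> \<beta> by (simp add: mult_A_tilde diagonal_aut_A_tilde mult_BijGroup graph_aut_def)
  qed (simp add: carrier_A_tilde_group diagonal_aut_A_tilde)
  then have "group_hom ?Aut (A_tilde_group G G f) (diagonal_aut G f)"
    using subgroup.subgroup_is_group[OF graph_aut_subgroup group_BijGroup] group_A_tilde
    by (simp add: group_hom_def group_hom_axioms_def)
  from group_hom.img_is_subgroup[OF this] show ?thesis
    by (simp add: A_bar_def Setcompr_eq_image)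
qed

section \<open>The induced permutation of the layers and the splitting\<close>

lemma layer_permutation:
  assumes \<phi>: "\<phi> \<in> A_tilde G G f"
  obtains \<alpha> where "\<alpha> \<in> graph_aut G" "\<forall>p\<in>W. fst (\<phi> p) = \<alpha> (fst p)"
proof -
  note b = BijD[OF A_tilde_Bij[OF \<phi>]]
  \<comment> \<open>The point \<open>(g, g)\<close> merely represents the layer of \<open>g\<close>;
    any other point of the layer gives the same value by \<open>A_tilde_layer\<close>.\<close>
  define \<alpha> where "\<alpha> = (\<lambda>g\<in>verts G. fst (\<phi> (g, g)))"
  have eq: "fst (\<phi> p) = \<alpha> (fst p)" if "p \<in> W" for p
    using that A_tilde_layer[OF conn \<phi> that, of "(fst p, fst p)"] by (auto simp: \<alpha>_def)
  have V: "\<alpha> g \<in> verts G" if "g \<in> verts G" for g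
    using b(1)[of "(g, g)"] that by (auto simp: \<alpha>_def)
  have surj: "verts G \<subseteq> \<alpha> ` verts G"
  proof
    fix g assume "g \<in> verts G"
    then have "(g, g) \<in> \<phi> ` W" using b(3) by simp
    then obtain p where "p \<in> W" "\<phi> p = (g, g)" by (metis imageE)
    then show "g \<in> \<alpha> ` verts G" using eq[of p] by auto
  qed
  \<comment> \<open>Injectivity comes from surjectivity on a finite set.\<close>
  have \<alpha>B: "\<alpha> \<in> Bij (verts G)"
    using surj V fin by (intro BijI) (auto simp: \<alpha>_def intro: finite_surj_inj)
  have "{\<alpha> u, \<alpha> v} \<in> edges G \<longleftrightarrow> {u, v} \<in> edges G" if uv: "u \<in> verts G" "v \<in> verts G" for u v
  proof
    assume "{u, v} \<in> edges G"
    then have "{\<phi> (u, f v), \<phi> (v, f u)} \<in> connecting_edges G f"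
      using \<phi> uv f_verts unfolding A_tilde_iff by (simp add: connecting_edges_iff)
    then show "{\<alpha> u, \<alpha> v} \<in> edges G"
      using eq uv f_verts by (simp add: connecting_edges_iff)
  next
    assume e: "{\<alpha> u, \<alpha> v} \<in> edges G"
    \<comment> \<open>Pull back the ends of the connecting edge between the layers of
      \<open>\<alpha> u\<close> and \<open>\<alpha> v\<close>. Injectivity of \<alpha> places the
      preimages in the layers of \<open>u\<close> and \<open>v\<close>, and they are joined by a
      connecting edge because \<phi> reflects those.\<close>
    have im: "(\<alpha> u, f (\<alpha> v)) \<in> \<phi> ` W" "(\<alpha> v, f (\<alpha> u)) \<in> \<phi> ` W"
      using b(3) V uv f_verts by auto
    from im(1) obtain p where p: "p \<in> W" "\<phi> p = (\<alpha> u, f (\<alpha> v))" by (metis imageE)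
    from im(2) obtain q where q: "q \<in> W" "\<phi> q = (\<alpha> v, f (\<alpha> u))" by (metis imageE)
    have "\<alpha> (fst p) = \<alpha> u" "\<alpha> (fst q) = \<alpha> v"
      using eq[OF p(1)] eq[OF q(1)] by (simp_all add: p(2) q(2))
    moreover have "fst p \<in> verts G" "fst q \<in> verts G"
      using p(1) q(1) by auto
    ultimately have "fst p = u" "fst q = v"
      using inj_onD[OF BijD(2)[OF \<alpha>B]] uv by blast+
    moreover have "{\<phi> p, \<phi> q} \<in> connecting_edges G f"
      using e by (simp add: connecting_edges_iff p(2) q(2))
    then have "{p, q} \<in> connecting_edges G f"
      using \<phi> p(1) q(1) unfolding A_tilde_iff by blast
    ultimately show "{u, v} \<in> edges G" by (simp add: connecting_edges_iff)
  qed
  then have "\<alpha> \<in> graph_aut G" using \<alpha>B by (simp add: graph_aut_def)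
  then show thesis using that eq by blast
qed

text \<open>The first coordinate of a diagonal automorphism is \<alpha> itself. In the kernel
  \<alpha> is thus the identity on \<open>verts G\<close>, and \<open>f\<close> cancels with its
  inverse in the second coordinate.\<close>

lemma A_bar_Int_layer_kernel: "A_bar G f \<inter> layer_kernel = {\<one>\<^bsub>A_tilde_group G G f\<^esub>}"
proof
  show "A_bar G f \<inter> layer_kernel \<subseteq> {\<one>\<^bsub>A_tilde_group G G f\<^esub>}"
  proof
    fix \<phi> assume "\<phi> \<in> A_bar G f \<inter> layer_kernel"
    then obtain \<alpha> where \<alpha>: "\<phi> = diagonal_aut G f \<alpha>"
      and k: "\<And>p. p \<in> W \<Longrightarrow> fst (\<phi> p) = fst p"
      by (auto simp: A_bar_def layer_kernel_def)
    have "\<alpha> g = g" if "g \<in> verts G" for g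
      using k[of "(g, g)"] that by (simp add: \<alpha> diagonal_aut_def)
    then show "\<phi> \<in> {\<one>\<^bsub>A_tilde_group G G f\<^esub>}"
      by (auto simp: \<alpha> one_A_tilde diagonal_aut_def restrict_def fun_eq_iff)
  qed
  show "{\<one>\<^bsub>A_tilde_group G G f\<^esub>} \<subseteq> A_bar G f \<inter> layer_kernel"
    using subgroup.one_closed[OF A_bar_subgroup]
      subgroup.one_closed[OF normal_imp_subgroup[OF layer_kernel_normal[OF conn]]] by simp
qed

text \<open>An automorphism \<phi> and the diagonal automorphism of its induced permutation move
  layers alike, so they differ by a right factor from the kernel.\<close>

lemma A_tilde_eq_A_bar_layer_kernel:
  "A_tilde G G f = A_bar G f <#>\<^bsub>A_tilde_group G G f\<^esub> layer_kernel"
proof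
  interpret A: group "A_tilde_group G G f" by (rule group_A_tilde)
  show "A_bar G f <#>\<^bsub>A_tilde_group G G f\<^esub> layer_kernel \<subseteq> A_tilde G G f"
    using A.set_mult_closed[of "A_bar G f" layer_kernel] subgroup.subset[OF A_bar_subgroup]
    by (auto simp: carrier_A_tilde_group layer_kernel_def)
  show "A_tilde G G f \<subseteq> A_bar G f <#>\<^bsub>A_tilde_group G G f\<^esub> layer_kernel"
  proof
    fix \<phi> assume \<phi>: "\<phi> \<in> A_tilde G G f"
    obtain \<alpha> where \<alpha>: "\<alpha> \<in> graph_aut G" and eq: "\<forall>p\<in>W. fst (\<phi> p) = \<alpha> (fst p)"
      by (rule layer_permutation[OF \<phi>])
    let ?d = "diagonal_aut G f \<alpha>" and ?i = "inv\<^bsub>A_tilde_group G G f\<^esub> (diagonal_aut G f \<alpha>)"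
    have d: "?d \<in> A_tilde G G f" by (rule diagonal_aut_A_tilde[OF \<alpha>])
    have i: "?i \<in> A_tilde G G f" using A.inv_closed d by (simp add: carrier_A_tilde_group)
    have "fst (compose W ?i \<phi> p) = fst p" if p: "p \<in> W" for p
    proof -
      have \<phi>p: "\<phi> p \<in> W" using BijD(1)[OF A_tilde_Bij[OF \<phi>] p] .
      have ip: "?i (\<phi> p) \<in> W" "?d (?i (\<phi> p)) = \<phi> p"
        using inv_BijGroup_f[OF A_tilde_Bij[OF d] \<phi>p] by (simp_all add: inv_A_tilde d)
      \<comment> \<open>The inverse is not computed: applying \<open>?d\<close> to
        \<open>?i (\<phi> p)\<close> returns \<open>\<phi> p\<close>, and comparing first
        coordinates leaves only \<alpha> to be cancelled.\<close>
      have "\<alpha> (fst (?i (\<phi> p))) = fst (?d (?i (\<phi> p)))"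
        using ip(1) by (auto simp: diagonal_aut_def)
      then have "\<alpha> (fst (?i (\<phi> p))) = \<alpha> (fst p)" using ip(2) bspec[OF eq p] by simp
      then show ?thesis using p ip graph_aut_eq_iff[OF \<alpha>] by (simp add: compose_eq mem_Times_iff)
    qed
    then have "?i \<otimes>\<^bsub>A_tilde_group G G f\<^esub> \<phi> \<in> layer_kernel"
      using A.m_closed[of ?i \<phi>] i \<phi> by (simp add: layer_kernel_def carrier_A_tilde_group mult_A_tilde)
    moreover have "?d \<in> A_bar G f" using \<alpha> by (auto simp: A_bar_def)
    moreover have "?d \<otimes>\<^bsub>A_tilde_group G G f\<^esub> (?i \<otimes>\<^bsub>A_tilde_group G G f\<^esub> \<phi>) = \<phi>"
      using d \<phi> i by (simp add: carrier_A_tilde_group flip: A.m_assoc)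
    ultimately show "\<phi> \<in> A_bar G f <#>\<^bsub>A_tilde_group G G f\<^esub> layer_kernel"
      unfolding set_mult_def by force
  qed
qed

end

theorem theorem3p27:
  fixes G :: "'a ugraph" and f :: "'a \<Rightarrow> 'a"
  assumes "simple_graph G" and "finite_graph G" and "connected_graph G"
    and "f \<in> graph_aut G"
  shows "B_hat G G f \<lhd> A_tilde_group G G f
    \<and> subgroup (A_bar G f) (A_tilde_group G G f)
    \<and> A_bar G f \<inter> B_hat G G f = {\<one>\<^bsub>A_tilde_group G G f\<^esub>}
    \<and> carrier (A_tilde_group G G f) = A_bar G f <#>\<^bsub>A_tilde_group G G f\<^esub> B_hat G G f"
proof -
  interpret diagonal_sierpinski G f
    using assms by unfold_locales (simp_all add: finite_graph_def)
  show ?thesis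
    \<comment> \<open>With \<open>B_hat\<close> replaced by the kernel, the four claims are the
      facts already shown about kernel and complement.\<close>
    unfolding B_hat_eq_layer_kernel[OF fin conn] carrier_A_tilde_group
    using layer_kernel_normal[OF conn] A_bar_subgroup A_bar_Int_layer_kernel
      A_tilde_eq_A_bar_layer_kernel by blast
qed

end
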